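(* Equip each zigzag snake graph $\mathcal{G}^z_N$ with its standard labeling. Then: (a) For every $n\ge2$, $|\Omega(\mathcal{G}^z_{n-1})| = C_n$. (b) For every $n\ge 3$ and $2\le k\le n+1$, the number of mixed dimer covers of $\mathcal{G}^z_{n-1}$ (standard labeling) whose final edge has multiplicity $n+1-k$ equals the number of mixed dimer covers of $\mathcal{G}^z_{n-2}$ with labeling $(1,2,\dots,n-2,\,n+1-k)$ (in the sense below), and both equal the ballot number $C_{n,n+2-k}$.
   Context: Mixed dimer covers: for a finite graph $\mathcal{G}=(V,E)$ and $\mathbf{n}\colon V\to\mathbb{N}$, a mixed dimer cover is a function $\omega\colon E\to\mathbb{N}$ with $\sum_{e\ni v}\omega(e)=\mathbf{n}(v)$ for each vertex $v$. Zigzag snake graph $\mathcal{G}^z_N$ ($N\ge1$): the union of $N$ unit squares (tiles) $T_1,\dots,T_N$ in the plane, with $T_{2j+1}$ having lower-left corner $(j,j)$ and $T_{2j}$ having lower-left corner $(j-1,j)$ (so $T_{i+1}$ lies above $T_i$ if $i$ is odd and to the right of $T_i$ if $i$ is even); vertices are the lattice points on the tiles, edges the unit sides. Its $2(N+1)$ vertices are partitioned into pairs $P_0,\dots,P_N$: for $1\le k\le N$, if $k=2j+1$ then $P_{k-1}=\{(j,j),(j+1,j)\}$, and if $k=2j$ then $P_{k-1}=\{(j-1,j),(j-1,j+1)\}$; $P_N$ consists of the two remaining vertices. For a sequence $(x_0,\dots,x_N)$ of non-negative integers, the labeling $(x_0,\dots,x_N)$ gives both vertices of $P_i$ the value $x_i$.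 The standard labeling is $(1,2,\dots,N+1)$, and $\Omega(\mathcal{G}^z_N)$ is the set of mixed dimer covers for it. The final edge of $\mathcal{G}^z_N$ is the right vertical edge of $T_N$ if $N$ is odd and the top horizontal edge of $T_N$ if $N$ is even. A permutation $\tau\in S_n$ is $132$-avoiding if there are no $j<k<\ell$ with $\tau(j)<\tau(\ell)<\tau(k)$. $C_n$ is the number of $132$-avoiding permutations in $S_n$ (the Catalan number), and the ballot number $C_{n,k}$ is the number of $132$-avoiding $\tau\in S_n$ with $\tau(1)=k$. *)

theory Defs
  imports "HOL-Library.FuncSet" "HOL-Combinatorics.Permutations"
begin

text \<open>A finite simple graph is given by its vertex set \<open>V\<close> and its set \<open>E\<close> of two-element
  edges. Covers are taken extensional outside \<open>E\<close>, so that they are counted as functions on \<open>E\<close>.\<close>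

definition mixed_dimer_covers :: "'v set \<Rightarrow> 'v set set \<Rightarrow> ('v \<Rightarrow> nat) \<Rightarrow> ('v set \<Rightarrow> nat) set" where
  "mixed_dimer_covers V E \<nn> =
     {\<omega> \<in> E \<rightarrow>\<^sub>E UNIV. \<forall>v\<in>V. (\<Sum>e\<in>{e \<in> E. v \<in> e}. \<omega> e) = \<nn> v}"

type_synonym point = "int \<times> int"

definition tile_vertices :: "point \<Rightarrow> point set" where
  "tile_vertices = (\<lambda>(a, b). {(a, b), (a + 1, b), (a, b + 1), (a + 1, b + 1)})"

definition tile_edges :: "point \<Rightarrow> point set set" where
  "tile_edges = (\<lambda>(a, b).
     {{(a, b), (a + 1, b)}, {(a, b + 1), (a + 1, b + 1)},
      {(a, b), (a, b + 1)}, {(a + 1, b), (a + 1, b + 1)}})"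

text \<open>Lower-left corner of the tile \<open>T\<^sub>i\<close>, for \<open>i \<ge> 1\<close>.\<close>

definition tile_corner :: "nat \<Rightarrow> point" where
  "tile_corner i =
     (let j = int (i div 2) in if odd i then (j, j) else (j - 1, j))"

definition zigzag_vertices :: "nat \<Rightarrow> point set" where
  "zigzag_vertices N = (\<Union>i\<in>{1..N}. tile_vertices (tile_corner i))"

definition zigzag_edges :: "nat \<Rightarrow> point set set" where
  "zigzag_edges N = (\<Union>i\<in>{1..N}. tile_edges (tile_corner i))"

text \<open>\<open>leading_pair k\<close> is the pair \<open>P\<^bsub>k-1\<^esub>\<close>, for \<open>1 \<le> k \<le> N\<close>: the bottom side of \<open>T\<^sub>k\<close> if \<open>k\<close> is
  odd, the left side of \<open>T\<^sub>k\<close> if \<open>k\<close> is even.\<close>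

definition leading_pair :: "nat \<Rightarrow> point set" where
  "leading_pair k =
     (let j = int (k div 2)
      in if odd k then {(j, j), (j + 1, j)} else {(j - 1, j), (j - 1, j + 1)})"

definition zigzag_pair :: "nat \<Rightarrow> nat \<Rightarrow> point set" where
  "zigzag_pair N i =
     (if i < N then leading_pair (i + 1)
      else zigzag_vertices N - (\<Union>k\<in>{1..N}. leading_pair k))"

text \<open>A labeling \<open>(x\<^sub>0, \<dots>, x\<^sub>N)\<close> is given by a function \<open>x\<close>, of which only the values on
  \<open>{0..N}\<close> matter.\<close>

definition zigzag_labeling :: "nat \<Rightarrow> (nat \<Rightarrow> nat) \<Rightarrow> point \<Rightarrow> nat" where
  "zigzag_labeling N x v = x (THE i. i \<le> N \<and> v \<in> zigzag_pair N i)"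

definition zigzag_covers :: "nat \<Rightarrow> (nat \<Rightarrow> nat) \<Rightarrow> (point set \<Rightarrow> nat) set" where
  "zigzag_covers N x =
     mixed_dimer_covers (zigzag_vertices N) (zigzag_edges N) (zigzag_labeling N x)"

definition standard_labels :: "nat \<Rightarrow> nat" where
  "standard_labels i = i + 1"

definition \<Omega> :: "nat \<Rightarrow> (point set \<Rightarrow> nat) set" where
  "\<Omega> N = zigzag_covers N standard_labels"

definition final_edge :: "nat \<Rightarrow> point set" where
  "final_edge N =
     (let (a, b) = tile_corner N
      in if odd N then {(a + 1, b), (a + 1, b + 1)} else {(a, b + 1), (a + 1, b + 1)})"

definition avoids_132 :: "nat \<Rightarrow> (nat \<Rightarrow> nat) \<Rightarrow> bool" where
  "avoids_132 n \<tau> \<longleftrightarrow>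
     \<not> (\<exists>j\<in>{1..n}. \<exists>k\<in>{1..n}. \<exists>l\<in>{1..n}. j < k \<and> k < l \<and> \<tau> j < \<tau> l \<and> \<tau> l < \<tau> k)"

definition catalan_number :: "nat \<Rightarrow> nat" where
  "catalan_number n = card {\<tau>. \<tau> permutes {1..n} \<and> avoids_132 n \<tau>}"

definition ballot_number :: "nat \<Rightarrow> nat \<Rightarrow> nat" where
  "ballot_number n k = card {\<tau>. \<tau> permutes {1..n} \<and> avoids_132 n \<tau> \<and> \<tau> 1 = k}"

text \<open>The sets \<open>zigzag_pair N i\<close> with \<open>i \<le> N\<close> partition the vertices, so the definite
  description in \<open>zigzag_labeling\<close> is proper.\<close>

lemma leading_pair_disjoint:
  assumes "k \<noteq> l"
  shows "leading_pair k \<inter> leading_pair l = {}"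
proof -
  have "k = 2 * (k div 2) + of_bool (odd k)" "l = 2 * (l div 2) + of_bool (odd l)"
    by simp_all
  then show ?thesis
    using assms by (auto simp: leading_pair_def Let_def split: if_splits)
qed

lemma leading_pair_subset:
  assumes "k \<in> {1..N}"
  shows "leading_pair k \<subseteq> zigzag_vertices N"
proof -
  have "leading_pair k \<subseteq> tile_vertices (tile_corner k)"
    by (auto simp: leading_pair_def tile_vertices_def tile_corner_def Let_def)
  with assms show ?thesis by (auto simp: zigzag_vertices_def)
qed

lemma zigzag_pair_unique:
  assumes "v \<in> zigzag_vertices N"
  shows "\<exists>!i. i \<le> N \<and> v \<in> zigzag_pair N i"
proof (cases "\<exists>k\<in>{1..N}. v \<in> leading_pair k")
  case True
  then obtain k where k: "k \<in> {1..N}" "v \<in> leading_pair k" by blast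
  show ?thesis
  proof (rule ex1I [of _ "k - 1"])
    show "k - 1 \<le> N \<and> v \<in> zigzag_pair N (k - 1)"
      using k by (auto simp: zigzag_pair_def)
  next
    fix i assume i: "i \<le> N \<and> v \<in> zigzag_pair N i"
    with k have "v \<in> leading_pair (i + 1)"
      by (auto simp: zigzag_pair_def split: if_splits)
    with k leading_pair_disjoint [of k "i + 1"] have "k = i + 1" by blast
    then show "i = k - 1" by simp
  qed
next
  case False
  with assms show ?thesis
    by (intro ex1I [of _ N]) (auto simp: zigzag_pair_def split: if_splits)
qed

end

theory Submission
  imports Defs
begin

text \<open>
  The vertices of the snake graph form a path \<open>a\<^sub>0, a\<^sub>1, \<dots>\<close> (the spine) together with one further
  vertex \<open>b\<^sub>i\<close> (the tip) for every \<open>i < N\<close>, adjacent to \<open>a\<^sub>i\<close> and \<open>a\<^bsub>i+2\<^esub>\<close> only; the pair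
  \<open>P\<^sub>i\<close> is \<open>{a\<^sub>i, b\<^sub>i}\<close> for \<open>i < N\<close>, and \<open>P\<^sub>N = {a\<^sub>N, a\<^bsub>N+1\<^esub>}\<close>. Let \<open>u\<^sub>i\<close> be the
  multiplicity of the edge \<open>b\<^sub>ia\<^bsub>i+2\<^esub>\<close>. Solving the equations at the spine vertices one after the
  other shows that \<open>u\<^sub>i\<close> is the sum of the multiplicities of the first \<open>i + 1\<close> edges of the path, so
  that covers correspond to nondecreasing sequences \<open>u\<^sub>0 \<le> \<dots> \<le> u\<^bsub>N-1\<^esub> \<le> x\<^sub>N\<close> with \<open>u\<^sub>i \<le> x\<^sub>i\<close>.
  The final edge carries \<open>u\<^bsub>N-1\<^esub>\<close>, which gives a recursion for their number.
  The ballot numbers satisfy the same recursion: putting a new first entry \<open>k\<close> before a 132-avoiding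
  \<open>\<sigma>\<close> preserves avoidance iff the entries of \<open>\<sigma>\<close> that are at least \<open>k\<close> increase, and as those
  exceeding \<open>\<sigma> 1\<close> always increase, this means \<open>\<sigma> 1 \<le> k\<close>.
\<close>

lemma card_eq_sum_card_fibres:
  assumes "finite A" "finite J" "f ` A \<subseteq> J"
  shows "card A = (\<Sum>j\<in>J. card {a \<in> A. f a = j})"
  using sum.group [OF assms, of "\<lambda>_. 1::nat"] by simp


section \<open>Covers as nondecreasing sequences\<close>

definition spine :: "nat \<Rightarrow> point" where
  "spine i = (int (i div 2), int (Suc i div 2))"

text \<open>While \<open>spine i\<close> is the lower-left corner of the tile with number
  \<open>Suc i\<close>, the tip is one of its two off-diagonal corners: the lower-right one for even
  \<open>i\<close>, the upper-left one for odd \<open>i\<close>. The other off-diagonal corner is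
  \<open>spine (Suc i)\<close>, and the upper-right corner is \<open>spine (i + 2)\<close>.\<close>

definition tip :: "nat \<Rightarrow> point" where
  "tip i = (if even i then (int (i div 2) + 1, int (i div 2)) else (int (i div 2), int (i div 2) + 2))"

definition spine_edge :: "nat \<Rightarrow> point set" where
  "spine_edge i = {spine i, spine (Suc i)}"

definition near_edge :: "nat \<Rightarrow> point set" where
  "near_edge i = {spine i, tip i}"

definition far_edge :: "nat \<Rightarrow> point set" where
  "far_edge i = {tip i, spine (i + 2)}"

text \<open>Coordinate sum and difference are the invariants that tell all vertices apart: the sum
  determines the index, and the difference is 0 or 1 on the spine but -1 or 2 at a tip.\<close>

lemma spine_coords:
  "fst (spine i) + snd (spine i) = int i" "snd (spine i) - fst (spine i) = of_bool (odd i)"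
proof -
  obtain j where "i = 2 * j \<or> i = Suc (2 * j)" by (metis evenE oddE Suc_eq_plus1)
  then show "fst (spine i) + snd (spine i) = int i" "snd (spine i) - fst (spine i) = of_bool (odd i)"
    by (elim disjE; simp add: spine_def)+
qed

lemma tip_coords:
  "fst (tip i) + snd (tip i) = int i + 1" "snd (tip i) - fst (tip i) = (if even i then -1 else 2)"
proof -
  obtain j where "i = 2 * j \<or> i = Suc (2 * j)" by (metis evenE oddE Suc_eq_plus1)
  then show "fst (tip i) + snd (tip i) = int i + 1"
    "snd (tip i) - fst (tip i) = (if even i then -1 else 2)"
    by (elim disjE; simp add: tip_def)+
qed

lemma spine_eq_iff [simp]: "spine i = spine j \<longleftrightarrow> i = j"
  by (metis spine_coords(1) of_nat_eq_iff)

lemma tip_eq_iff [simp]: "tip i = tip j \<longleftrightarrow> i = j"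
  by (metis tip_coords(1) add_right_cancel of_nat_eq_iff)

lemma spine_neq_tip [simp]: "spine i \<noteq> tip j" "tip j \<noteq> spine i"
proof -
  have "of_bool (odd i) \<noteq> (if even j then -1 else 2 :: int)" by simp
  then show "spine i \<noteq> tip j" "tip j \<noteq> spine i"
    by (metis spine_coords(2) tip_coords(2))+
qed

lemma tile_vertices_eq:
  "tile_vertices (tile_corner (Suc i)) = {spine i, tip i, spine (Suc i), spine (i + 2)}"
proof (cases "even i")
  case True
  then obtain j where "i = 2 * j" by (elim evenE)
  then show ?thesis
    by (auto simp: tile_vertices_def tile_corner_def spine_def tip_def Let_def)
next
  case False
  then obtain j where "i = 2 * j + 1" by (elim oddE)
  then show ?thesis
    by (auto simp: tile_vertices_def tile_corner_def spine_def tip_def Let_def)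
qed

lemma tile_edges_eq:
  "tile_edges (tile_corner (Suc i)) =
     {spine_edge i, spine_edge (Suc i), near_edge i, far_edge i}"
proof (cases "even i")
  case True
  then obtain j where "i = 2 * j" by (elim evenE)
  then show ?thesis
    by (auto simp: tile_edges_def tile_corner_def spine_def tip_def Let_def
        spine_edge_def near_edge_def far_edge_def insert_commute add.commute)
next
  case False
  then obtain j where "i = 2 * j + 1" by (elim oddE)
  then show ?thesis
    by (auto simp: tile_edges_def tile_corner_def spine_def tip_def Let_def
        spine_edge_def near_edge_def far_edge_def insert_commute add.commute)
qed

lemma leading_pair_eq: "leading_pair (Suc i) = {spine i, tip i}"
proof (cases "even i")
  case True
  then obtain j where "i = 2 * j" by (elim evenE)
  then show ?thesis
    by (auto simp: leading_pair_def spine_def tip_def Let_def)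
next
  case False
  then obtain j where "i = 2 * j + 1" by (elim oddE)
  then show ?thesis
    by (auto simp: leading_pair_def spine_def tip_def Let_def)
qed

lemma final_edge_eq: "final_edge (Suc i) = far_edge i"
proof (cases "even i")
  case True
  then obtain j where "i = 2 * j" by (elim evenE)
  then show ?thesis
    by (auto simp: final_edge_def tile_corner_def far_edge_def spine_def tip_def Let_def)
next
  case False
  then obtain j where "i = 2 * j + 1" by (elim oddE)
  then show ?thesis
    by (auto simp: final_edge_def tile_corner_def far_edge_def spine_def tip_def Let_def)
qed

lemma UN_atLeast1: "(\<Union>i\<in>{1..N}. F i) = (\<Union>i<N. F (Suc i))"
  by (simp only: image_Suc_lessThan [symmetric] image_image)

lemma zigzag_vertices_Suc:
  "zigzag_vertices (Suc N) =
     zigzag_vertices N \<union> {spine N, tip N, spine (Suc N), spine (N + 2)}"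
  unfolding zigzag_vertices_def UN_atLeast1 lessThan_Suc tile_vertices_eq by blast

lemma zigzag_edges_Suc:
  "zigzag_edges (Suc N) =
     zigzag_edges N \<union> {spine_edge N, spine_edge (Suc N), near_edge N, far_edge N}"
  unfolding zigzag_edges_def UN_atLeast1 lessThan_Suc tile_edges_eq by blast

lemma zigzag_vertices_eq:
  assumes "N \<ge> 1"
  shows "zigzag_vertices N = spine ` {..Suc N} \<union> tip ` {..<N}"
proof -
  \<comment> \<open>The induction starts at one tile, since for \<open>N = 0\<close> the left side
    is empty while the right side is not.\<close>
  have "zigzag_vertices (Suc M) = spine ` {..Suc (Suc M)} \<union> tip ` {..<Suc M}" for M
  proof (induction M)
    case 0
    have "zigzag_vertices 0 = {}" by (simp add: zigzag_vertices_def)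
    then show ?case
      unfolding zigzag_vertices_Suc by (simp add: atMost_Suc lessThan_Suc insert_commute)
  next
    case (Suc M)
    show ?case
      unfolding zigzag_vertices_Suc [of "Suc M"] Suc.IH
      by (simp add: atMost_Suc lessThan_Suc insert_commute)
  qed
  with assms show ?thesis by (cases N) simp_all
qed

lemma zigzag_edges_eq:
  assumes "N \<ge> 1"
  shows "zigzag_edges N = spine_edge ` {..N} \<union> near_edge ` {..<N} \<union> far_edge ` {..<N}"
proof -
  have "zigzag_edges (Suc M) =
    spine_edge ` {..Suc M} \<union> near_edge ` {..<Suc M} \<union> far_edge ` {..<Suc M}" for M
  proof (induction M)
    case 0
    have "zigzag_edges 0 = {}" by (simp add: zigzag_edges_def)
    then show ?case
      unfolding zigzag_edges_Suc by (simp add: atMost_Suc lessThan_Suc insert_commute)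
  next
    case (Suc M)
    show ?case
      unfolding zigzag_edges_Suc [of "Suc M"] Suc.IH
      by (simp add: atMost_Suc lessThan_Suc insert_commute)
  qed
  with assms show ?thesis by (cases N) simp_all
qed

lemma zigzag_labeling_eq:
  assumes "v \<in> zigzag_pair N i" "i \<le> N" "v \<in> zigzag_vertices N"
  shows "zigzag_labeling N x v = x i"
  unfolding zigzag_labeling_def
  using the1_equality [OF zigzag_pair_unique [OF assms(3)]] assms(1,2) by blast

lemma zigzag_labeling_tip: "i < N \<Longrightarrow> zigzag_labeling N x (tip i) = x i"
  by (rule zigzag_labeling_eq) (auto simp: zigzag_pair_def leading_pair_eq zigzag_vertices_eq)

text \<open>The last two spine vertices \<open>spine N\<close> and \<open>spine (Suc N)\<close>
  together form the final pair and share the label \<open>x N\<close>, hence the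
  \<open>min\<close>.\<close>

lemma zigzag_labeling_spine:
  assumes "N \<ge> 1" "i \<le> Suc N"
  shows "zigzag_labeling N x (spine i) = x (min i N)"
proof (cases "i < N")
  case True
  then show ?thesis
    by (intro zigzag_labeling_eq) (auto simp: zigzag_pair_def leading_pair_eq zigzag_vertices_eq)
next
  case False
  with assms show ?thesis
    by (intro zigzag_labeling_eq)
      (auto simp: zigzag_pair_def leading_pair_eq zigzag_vertices_eq UN_atLeast1 simp del: One_nat_def)
qed

section \<open>Incidences and the equations at the vertices\<close>

lemma edge_eq_iffs [simp]:
  "spine_edge i = spine_edge j \<longleftrightarrow> i = j"
  "near_edge i = near_edge j \<longleftrightarrow> i = j"
  "far_edge i = far_edge j \<longleftrightarrow> i = j"
  "spine_edge i \<noteq> near_edge j" "near_edge j \<noteq> spine_edge i"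
  "spine_edge i \<noteq> far_edge j" "far_edge j \<noteq> spine_edge i"
  "near_edge i \<noteq> far_edge j" "far_edge j \<noteq> near_edge i"
  by (auto simp: spine_edge_def near_edge_def far_edge_def doubleton_eq_iff)

lemma mem_edge_iffs [simp]:
  "spine i \<in> spine_edge j \<longleftrightarrow> i = j \<or> i = Suc j"
  "spine i \<in> near_edge j \<longleftrightarrow> i = j"
  "spine i \<in> far_edge j \<longleftrightarrow> i = j + 2"
  "tip i \<notin> spine_edge j"
  "tip i \<in> near_edge j \<longleftrightarrow> i = j"
  "tip i \<in> far_edge j \<longleftrightarrow> i = j"
  by (auto simp: spine_edge_def near_edge_def far_edge_def)

lemma sum_incident_tip:
  assumes "i < N"
  shows "(\<Sum>e\<in>{e \<in> zigzag_edges N. tip i \<in> e}. \<omega> e) = \<omega> (near_edge i) + \<omega> (far_edge i)"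
proof -
  have "{e \<in> zigzag_edges N. tip i \<in> e} = {near_edge i, far_edge i}"
    using assms by (auto simp: zigzag_edges_eq)
  then show ?thesis by simp
qed

lemma sum_incident_spine:
  fixes \<omega> :: "point set \<Rightarrow> nat"
  assumes "N \<ge> 1" "i \<le> Suc N"
  shows "(\<Sum>e\<in>{e \<in> zigzag_edges N. spine i \<in> e}. \<omega> e) =
    (if i \<le> N then \<omega> (spine_edge i) else 0) + (if i \<ge> 1 then \<omega> (spine_edge (i - 1)) else 0)
    + (if i < N then \<omega> (near_edge i) else 0) + (if i \<ge> 2 then \<omega> (far_edge (i - 2)) else 0)"
proof -
  have "{e \<in> zigzag_edges N. spine i \<in> e} =
      (if i \<le> N then {spine_edge i} else {}) \<union> (if i \<ge> 1 then {spine_edge (i - 1)} else {})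
      \<union> (if i < N then {near_edge i} else {}) \<union> (if i \<ge> 2 then {far_edge (i - 2)} else {})"
    (is "_ = ?A \<union> ?B \<union> ?C \<union> ?D")
  proof -
    consider "i = 0" | "i = 1" | j where "i = Suc (Suc j)"
      by (metis One_nat_def not0_implies_Suc)
    then show ?thesis
      by cases (use assms in \<open>auto simp: zigzag_edges_eq\<close>)
  qed
  moreover have "?A \<inter> ?B = {}" "(?A \<union> ?B) \<inter> ?C = {}" "(?A \<union> ?B \<union> ?C) \<inter> ?D = {}"
    by auto
  ultimately show ?thesis
    by (simp add: sum.union_disjoint)
qed

text \<open>The equations at the tips eliminate the near edges. Write \<open>s i\<close> for the
  multiplicity of \<open>spine_edge i\<close> and \<open>u i\<close> for that of
  \<open>far_edge i\<close>, with the convention \<open>u N = x N\<close>. The equation at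
  \<open>spine i\<close> for \<open>2 \<le> i\<close> and \<open>i \<le> N\<close> then reads
  \<open>s i + s (i - 1) + u (i - 2) = u i\<close>. Substituting the relation for
  \<open>i - 2\<close>, namely \<open>u (i - 2) + s (i - 1) = u (i - 1)\<close>, leaves
  \<open>u (i - 1) + s i = u i\<close>.\<close>

lemma zigzag_covers_iff:
  fixes x :: "nat \<Rightarrow> nat"
  assumes "N \<ge> 1"
  defines "u \<equiv> \<lambda>\<omega> i. if i < N then \<omega> (far_edge i) else x N"
  shows "\<omega> \<in> zigzag_covers N x \<longleftrightarrow>
    \<omega> \<in> zigzag_edges N \<rightarrow>\<^sub>E UNIV \<and>
    (\<forall>i<N. \<omega> (near_edge i) + \<omega> (far_edge i) = x i) \<and>
    \<omega> (spine_edge 0) = u \<omega> 0 \<and>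
    (\<forall>i<N. u \<omega> i + \<omega> (spine_edge (Suc i)) = u \<omega> (Suc i))"
proof -
  let ?S = "\<lambda>i. (\<Sum>e\<in>{e \<in> zigzag_edges N. spine i \<in> e}. \<omega> e)"
  let ?tips = "\<forall>i<N. \<omega> (near_edge i) + \<omega> (far_edge i) = x i"
  have "(\<forall>v\<in>zigzag_vertices N. (\<Sum>e\<in>{e \<in> zigzag_edges N. v \<in> e}. \<omega> e) = zigzag_labeling N x v)
    \<longleftrightarrow> (\<forall>i\<le>Suc N. ?S i = x (min i N)) \<and> ?tips"
    using assms(1)
    by (auto simp: zigzag_vertices_eq ball_Un sum_incident_tip zigzag_labeling_tip
        zigzag_labeling_spine)
  moreover have "(\<forall>i\<le>Suc N. ?S i = x (min i N)) \<longleftrightarrow>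
     \<omega> (spine_edge 0) = u \<omega> 0 \<and> (\<forall>i<N. u \<omega> i + \<omega> (spine_edge (Suc i)) = u \<omega> (Suc i))"
    (is "?L \<longleftrightarrow> ?R") if tips: ?tips
  proof
    assume L: ?L
    have 0: "\<omega> (spine_edge 0) = u \<omega> 0"
      using L [rule_format, of 0] tips assms(1)
      by (auto simp: sum_incident_spine u_def split: if_splits)
    have "u \<omega> i + \<omega> (spine_edge (Suc i)) = u \<omega> (Suc i)" if "i < N" for i
      using that
    proof (induction i)
      case base: 0
      then show ?case
        using L [rule_format, of 1] tips [rule_format, of 1] 0
        by (cases "N = 1") (auto simp: sum_incident_spine u_def split: if_splits)
    next
      case (Suc i)
      \<comment> \<open>If \<open>Suc (Suc i) = N\<close>, this vertex has no near edge, and the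
        convention \<open>u \<omega> N = x N\<close> yields the same relation.\<close>
      then show ?case
        using L [rule_format, of "Suc (Suc i)"] tips [rule_format, of "Suc (Suc i)"]
        by (cases "N = Suc (Suc i)") (auto simp: sum_incident_spine u_def min_def split: if_splits)
    qed
    with 0 show ?R by blast
  next
    assume R: ?R
    show ?L
    proof (intro allI impI)
      fix i assume i: "i \<le> Suc N"
      consider "i = 0" | "i = 1" | j where "i = Suc (Suc j)"
        by (metis One_nat_def not0_implies_Suc)
      then show "?S i = x (min i N)"
      proof cases
        case 1
        then show ?thesis
          using R tips [rule_format, of 0] assms(1) by (auto simp: sum_incident_spine u_def)
      next
        case 2
        then show ?thesis
          using R tips [rule_format, of 1] assms(1)
          by (cases "N = 1") (auto simp: sum_incident_spine u_def min_def split: if_splits)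
      next
        case 3
        then have "j < N" "Suc j \<le> N" using i by auto
        \<comment> \<open>For \<open>i \<le> N\<close> the equation is the sum of the relations for
          \<open>j\<close> and \<open>Suc j\<close>. For \<open>i = Suc N\<close>, that is
          \<open>N = Suc j\<close>, it is the relation for \<open>j\<close> itself.\<close>
        then show ?thesis
          using R [THEN conjunct2, rule_format, of j] R [THEN conjunct2, rule_format, of "Suc j"]
            tips [rule_format, of "Suc (Suc j)"] assms(1) 3
          by (cases "N = Suc j"; cases "N = Suc (Suc j)")
            (auto simp: sum_incident_spine u_def min_def split: if_splits)
      qed
    qed
  qed
  ultimately show ?thesis
    unfolding zigzag_covers_def mixed_dimer_covers_def by auto
qed

text \<open>The three families of edges are disjoint and injectively indexed, so multiplicities can
  be prescribed on each of them independently.\<close>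

lemma edge_function_exists:
  assumes "N \<ge> 1"
  obtains \<omega> :: "point set \<Rightarrow> nat" where "\<omega> \<in> zigzag_edges N \<rightarrow>\<^sub>E UNIV"
    "\<And>i. i \<le> N \<Longrightarrow> \<omega> (spine_edge i) = f i"
    "\<And>i. i < N \<Longrightarrow> \<omega> (near_edge i) = g i"
    "\<And>i. i < N \<Longrightarrow> \<omega> (far_edge i) = h i"
proof
  let ?\<omega> = "\<lambda>e\<in>zigzag_edges N. if e \<in> range spine_edge then f (inv spine_edge e)
      else if e \<in> range near_edge then g (inv near_edge e) else h (inv far_edge e)"
  have inj: "inj spine_edge" "inj near_edge" "inj far_edge"
    by (auto intro: injI)
  show "?\<omega> \<in> zigzag_edges N \<rightarrow>\<^sub>E UNIV" by simp
  show "?\<omega> (spine_edge i) = f i" if "i \<le> N" for i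
    using assms that inj by (auto simp: zigzag_edges_eq)
  show "?\<omega> (near_edge i) = g i" if "i < N" for i
    using assms that inj by (auto simp: zigzag_edges_eq)
  show "?\<omega> (far_edge i) = h i" if "i < N" for i
    using assms that inj by (auto simp: zigzag_edges_eq)
qed

text \<open>The last label enters as a separate bound \<open>m\<close>, so that the recursion can
  vary it while the other labels stay fixed.\<close>

definition bounded_seqs :: "nat \<Rightarrow> (nat \<Rightarrow> nat) \<Rightarrow> nat \<Rightarrow> (nat \<Rightarrow> nat) set" where
  "bounded_seqs N x m =
     {u \<in> {..<N} \<rightarrow>\<^sub>E UNIV. mono_on {..<N} u \<and> (\<forall>i<N. u i \<le> x i \<and> u i \<le> m)}"

text \<open>The far edges determine a cover: a near edge carries the complement to
  \<open>x i\<close>, and the spine edges carry the successive differences of \<open>u\<close>.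
  Monotonicity and the bounds say exactly that these values are non-negative.\<close>

lemma zigzag_covers_bij_betw:
  assumes N: "N \<ge> 1"
  shows "bij_betw (\<lambda>\<omega>. \<lambda>i\<in>{..<N}. \<omega> (far_edge i)) (zigzag_covers N x) (bounded_seqs N x (x N))"
    (is "bij_betw ?\<Phi> _ _")
proof (rule bij_betw_imageI)
  show "inj_on ?\<Phi> (zigzag_covers N x)"
  proof (rule inj_onI)
    fix \<omega> \<omega>' assume c: "\<omega> \<in> zigzag_covers N x" "\<omega>' \<in> zigzag_covers N x"
      and eq: "?\<Phi> \<omega> = ?\<Phi> \<omega>'"
    note c' = c [unfolded zigzag_covers_iff [OF N]]
    have far: "\<omega> (far_edge i) = \<omega>' (far_edge i)" if "i < N" for i
      using fun_cong [OF eq, of i] that by simp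
    have near: "\<omega> (near_edge i) = \<omega>' (near_edge i)" if "i < N" for i
      using c' far [OF that] that by (metis add_right_cancel)
    have spine: "\<omega> (spine_edge i) = \<omega>' (spine_edge i)" if "i \<le> N" for i
    proof (cases i)
      case 0
      then show ?thesis using c' far [of 0] N by simp
    next
      case (Suc j)
      let ?u = "\<lambda>\<omega> i. if i < N then \<omega> (far_edge i) else x N"
      have "?u \<omega> j = ?u \<omega>' j" "?u \<omega> i = ?u \<omega>' i" by (simp_all add: far)
      with c' Suc that show ?thesis by (metis Suc_le_eq add_left_cancel)
    qed
    show "\<omega> = \<omega>'"
    proof (rule PiE_ext)
      show "\<omega> \<in> zigzag_edges N \<rightarrow>\<^sub>E UNIV" "\<omega>' \<in> zigzag_edges N \<rightarrow>\<^sub>E UNIV"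
        using c' by blast+
      show "\<omega> e = \<omega>' e" if "e \<in> zigzag_edges N" for e
        using that far near spine N by (auto simp: zigzag_edges_eq)
    qed
  qed
  show "?\<Phi> ` zigzag_covers N x = bounded_seqs N x (x N)"
  proof (intro equalityI subsetI)
    fix v assume "v \<in> ?\<Phi> ` zigzag_covers N x"
    then obtain \<omega> where v: "v = ?\<Phi> \<omega>" and c: "\<omega> \<in> zigzag_covers N x" by blast
    note c' = c [unfolded zigzag_covers_iff [OF N]]
    define u where "u i = (if i < N then \<omega> (far_edge i) else x N)" for i
    \<comment> \<open>Beyond \<open>N\<close> the sequence \<open>u\<close> is constant, so it is
      nondecreasing on all naturals.\<close>
    have step: "u i \<le> u (Suc i)" for i
    proof (cases "i < N")
      case True
      with c' show ?thesis unfolding u_def by (metis le_add1)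
    qed (simp add: u_def)
    have mono: "u i \<le> u j" if "i \<le> j" for i j
      using lift_Suc_mono_le [of u, OF step that] .
    have bound: "u i \<le> x i" if "i < N" for i
      using c' that unfolding u_def by (metis le_add2)
    have "v = restrict u {..<N}" by (auto simp: v u_def)
    moreover have "u N = x N" by (simp add: u_def)
    ultimately show "v \<in> bounded_seqs N x (x N)"
      using mono bound by (auto simp: bounded_seqs_def mono_on_def) (metis less_imp_le)
  next
    fix v assume v: "v \<in> bounded_seqs N x (x N)"
    define u where "u i = (if i < N then v i else x N)" for i
    have u_mono: "u i \<le> u (Suc i)" if "i < N" for i
      using v that by (auto simp: bounded_seqs_def u_def mono_on_def)
    \<comment> \<open>The truncated subtractions are genuine differences, because \<open>u\<close>
      is nondecreasing up to \<open>N\<close> and \<open>v i \<le> x i\<close>.\<close>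
    obtain \<omega> where ext: "\<omega> \<in> zigzag_edges N \<rightarrow>\<^sub>E UNIV"
      and \<omega>: "\<And>i. i \<le> N \<Longrightarrow> \<omega> (spine_edge i) = (if i = 0 then u 0 else u i - u (i - 1))"
        "\<And>i. i < N \<Longrightarrow> \<omega> (near_edge i) = x i - v i"
        "\<And>i. i < N \<Longrightarrow> \<omega> (far_edge i) = v i"
      using edge_function_exists [OF N, of "\<lambda>i. if i = 0 then u 0 else u i - u (i - 1)"
          "\<lambda>i. x i - v i" v] by blast
    have u_eq: "(if i < N then \<omega> (far_edge i) else x N) = u i" for i
      by (simp add: \<omega> u_def)
    have "\<omega> \<in> zigzag_covers N x"
      unfolding zigzag_covers_iff [OF N] u_eq
      using v u_mono ext by (auto simp: \<omega> bounded_seqs_def)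
    moreover have "v = ?\<Phi> \<omega>"
      using v by (auto simp: bounded_seqs_def \<omega> PiE_def extensional_def)
    ultimately show "v \<in> ?\<Phi> ` zigzag_covers N x" by blast
  qed
qed

section \<open>Counting by the last entry\<close>

lemma finite_bounded_seqs: "finite (bounded_seqs N x m)"
proof (rule finite_subset)
  show "bounded_seqs N x m \<subseteq> {..<N} \<rightarrow>\<^sub>E {..m}"
    by (auto simp: bounded_seqs_def PiE_def)
  show "finite ({..<N} \<rightarrow>\<^sub>E {..m})" by (intro finite_PiE) auto
qed

text \<open>By monotonicity the last entry becomes the common upper bound of the earlier ones.
  Overwriting it with \<open>undefined\<close> makes the shortened sequence extensional on its
  smaller domain.\<close>

lemma bounded_seqs_Suc_iff:
  "u \<in> bounded_seqs (Suc N) x m \<longleftrightarrow>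
     u N \<le> x N \<and> u N \<le> m \<and> u(N := undefined) \<in> bounded_seqs N x (u N)"
proof -
  have "u \<in> {..<Suc N} \<rightarrow>\<^sub>E UNIV \<longleftrightarrow> u(N := undefined) \<in> {..<N} \<rightarrow>\<^sub>E UNIV"
    by (auto simp: PiE_iff extensional_def less_Suc_eq)
  moreover have "mono_on {..<Suc N} u \<longleftrightarrow> mono_on {..<N} (u(N := undefined)) \<and> (\<forall>i<N. u i \<le> u N)"
    by (fastforce simp: mono_on_def less_Suc_eq)
  moreover have "(\<forall>i<Suc N. u i \<le> x i \<and> u i \<le> m) \<longleftrightarrow>
      u N \<le> x N \<and> u N \<le> m \<and> (\<forall>i<N. u i \<le> x i)" if "\<forall>i<N. u i \<le> u N"
    using that le_trans by (auto simp: less_Suc_eq)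
  ultimately show ?thesis
    unfolding bounded_seqs_def by auto
qed

lemma card_bounded_seqs_fibre:
  assumes "j \<le> x N" "j \<le> m"
  shows "card {u \<in> bounded_seqs (Suc N) x m. u N = j} = card (bounded_seqs N x j)"
proof (rule bij_betw_same_card [OF bij_betw_byWitness [where f = "\<lambda>u. u(N := undefined)"
      and f' = "\<lambda>u. u(N := j)"]])
  let ?A = "{u \<in> bounded_seqs (Suc N) x m. u N = j}"
  have undef: "u(N := undefined) = u" if "u \<in> bounded_seqs N x j" for u
    using that by (auto simp: bounded_seqs_def PiE_iff extensional_def)
  show "\<forall>u\<in>?A. (u(N := undefined))(N := j) = u"
    unfolding fun_upd_upd by (intro ballI fun_upd_idem) simp
  show "\<forall>u\<in>bounded_seqs N x j. (u(N := j))(N := undefined) = u"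
    using undef by simp
  show "(\<lambda>u. u(N := undefined)) ` ?A \<subseteq> bounded_seqs N x j"
    by (auto simp: bounded_seqs_Suc_iff)
  show "(\<lambda>u. u(N := j)) ` bounded_seqs N x j \<subseteq> ?A"
    using assms undef by (auto simp: bounded_seqs_Suc_iff)
qed

lemma card_bounded_seqs_Suc:
  "card (bounded_seqs (Suc N) x m) = (\<Sum>j\<le>min m (x N). card (bounded_seqs N x j))"
proof -
  have "card (bounded_seqs (Suc N) x m) =
      (\<Sum>j\<le>min m (x N). card {u \<in> bounded_seqs (Suc N) x m. u N = j})"
    by (rule card_eq_sum_card_fibres) (auto simp: finite_bounded_seqs, auto simp: bounded_seqs_def)
  then show ?thesis by (simp add: card_bounded_seqs_fibre)
qed

lemma card_zigzag_covers:
  assumes "N \<ge> 1"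
  shows "card (zigzag_covers N x) = card (bounded_seqs N x (x N))"
  by (rule bij_betw_same_card [OF zigzag_covers_bij_betw [OF assms]])

text \<open>The final edge is \<open>far_edge N\<close>, so fixing its multiplicity fixes the last
  entry of the corresponding sequence.\<close>

lemma card_zigzag_covers_final_edge:
  assumes "j \<le> x N" "j \<le> x (Suc N)"
  shows "card {\<omega> \<in> zigzag_covers (Suc N) x. \<omega> (final_edge (Suc N)) = j} = card (bounded_seqs N x j)"
proof -
  let ?\<Phi> = "\<lambda>\<omega>. \<lambda>i\<in>{..<Suc N}. \<omega> (far_edge i)"
  let ?A = "{\<omega> \<in> zigzag_covers (Suc N) x. \<omega> (final_edge (Suc N)) = j}"
  have bij: "bij_betw ?\<Phi> (zigzag_covers (Suc N) x) (bounded_seqs (Suc N) x (x (Suc N)))"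
    by (rule zigzag_covers_bij_betw) simp
  have "?\<Phi> ` ?A = {u \<in> ?\<Phi> ` zigzag_covers (Suc N) x. u N = j}"
    by (auto simp: final_edge_eq)
  also have "\<dots> = {u \<in> bounded_seqs (Suc N) x (x (Suc N)). u N = j}"
    by (simp only: bij_betw_imp_surj_on [OF bij])
  finally have "bij_betw ?\<Phi> ?A {u \<in> bounded_seqs (Suc N) x (x (Suc N)). u N = j}"
    by (intro bij_betw_subset [OF bij]) auto
  then have "card ?A = card {u \<in> bounded_seqs (Suc N) x (x (Suc N)). u N = j}"
    by (rule bij_betw_same_card)
  with assms show ?thesis by (simp add: card_bounded_seqs_fibre)
qed


section \<open>Deleting the first entry of a permutation\<close>

text \<open>The increasing enumeration of the naturals other than \<open>k\<close>, used to make
  room for the new value.\<close>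

definition skip :: "nat \<Rightarrow> nat \<Rightarrow> nat" where
  "skip k v = (if v < k then v else Suc v)"

definition insert_first :: "nat \<Rightarrow> (nat \<Rightarrow> nat) \<Rightarrow> nat \<Rightarrow> nat" where
  "insert_first k \<sigma> i = (if i = 1 then k else skip k (\<sigma> (i - 1)))"

lemma skip_less_iff [simp]: "skip k v < skip k w \<longleftrightarrow> v < w"
  by (auto simp: skip_def)

lemma skip_eq_iff [simp]: "skip k v = skip k w \<longleftrightarrow> v = w"
  by (auto simp: skip_def)

lemma skip_neq [simp]: "skip k v \<noteq> k" "k \<noteq> skip k v"
  by (auto simp: skip_def)

lemma less_skip_iff [simp]: "k < skip k v \<longleftrightarrow> k \<le> v"
  by (auto simp: skip_def)

lemma insert_first_permutes:
  assumes \<sigma>: "\<sigma> permutes {1..n}" and k: "k \<in> {1..Suc n}"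
  shows "insert_first k \<sigma> permutes {1..Suc n}"
proof (rule bij_imp_permutes)
  have inj: "inj_on (insert_first k \<sigma>) {1..Suc n}"
    by (auto simp: inj_on_def insert_first_def permutes_inj [OF \<sigma>, THEN inj_eq] split: if_splits)
  have "insert_first k \<sigma> i \<in> {1..Suc n}" if "i \<in> {1..Suc n}" for i
  proof (cases "i = 1")
    case False
    then have "i - 1 \<in> {1..n}" using that by auto
    then have "\<sigma> (i - 1) \<in> {1..n}" using permutes_in_image [OF \<sigma>] by blast
    with False show ?thesis by (auto simp: insert_first_def skip_def)
  qed (use k in \<open>auto simp: insert_first_def\<close>)
  then have "insert_first k \<sigma> ` {1..Suc n} = {1..Suc n}"
    by (intro endo_inj_surj [OF _ _ inj]) auto
  with inj show "bij_betw (insert_first k \<sigma>) {1..Suc n} {1..Suc n}"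
    by (simp add: bij_betw_def)
  show "insert_first k \<sigma> i = i" if "i \<notin> {1..Suc n}" for i
  proof -
    \<comment> \<open>This includes \<open>i = 0\<close>, where \<open>i - 1 = 0\<close>. For
      \<open>i > Suc n\<close>, \<open>skip k\<close> raises \<open>i - 1\<close> back to
      \<open>i\<close> because \<open>k \<le> i - 1\<close>.\<close>
    have "i - 1 \<notin> {1..n}" using that by auto
    then have "\<sigma> (i - 1) = i - 1" using \<sigma> by (simp add: permutes_not_in)
    with that k show ?thesis by (auto simp: insert_first_def skip_def)
  qed
qed

lemma insert_first_surj:
  assumes \<tau>: "\<tau> permutes {1..Suc n}"
  obtains \<sigma> where "\<sigma> permutes {1..n}" "\<tau> = insert_first (\<tau> 1) \<sigma>"
proof
  define k where "k = \<tau> 1"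
  have k: "k \<in> {1..Suc n}" using permutes_in_image [OF \<tau>, of 1] by (simp add: k_def)
  \<comment> \<open>The value at 0 is set apart because \<open>\<tau> (Suc 0)\<close> is the deleted
    entry, whereas \<open>\<sigma>\<close> has to fix 0.\<close>
  define \<sigma> where "\<sigma> i = (if i = 0 then 0 else if \<tau> (Suc i) < k then \<tau> (Suc i) else \<tau> (Suc i) - 1)" for i
  have neq: "\<tau> i \<noteq> k" if "i \<noteq> 1" for i
    using that permutes_inj [OF \<tau>] by (auto simp: k_def inj_eq)
  have \<tau>0: "\<tau> 0 = 0" using \<tau> by (simp add: permutes_not_in)
  have skip_\<sigma>: "skip k (\<sigma> i) = \<tau> (Suc i)" if "i \<noteq> 0" for i
    using that neq [of "Suc i"] by (auto simp: \<sigma>_def skip_def)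
  show eq: "\<tau> = insert_first (\<tau> 1) \<sigma>"
  proof
    fix i :: nat
    consider "i = 0" | "i = 1" | "i \<noteq> 1" "i - 1 \<noteq> 0"
      by (cases "i \<le> 1") (auto simp: le_Suc_eq)
    then have "\<tau> i = insert_first k \<sigma> i"
    proof cases
      case 1
      then show ?thesis using \<tau>0 k by (simp add: insert_first_def \<sigma>_def skip_def)
    next
      case 2
      then show ?thesis by (simp add: insert_first_def k_def)
    next
      case 3
      then show ?thesis using skip_\<sigma> [of "i - 1"] by (simp add: insert_first_def)
    qed
    then show "\<tau> i = insert_first (\<tau> 1) \<sigma> i" by (simp add: k_def)
  qed
  show "\<sigma> permutes {1..n}"
  proof (rule bij_imp_permutes)
    have inj: "inj_on \<sigma> {1..n}"
    proof (rule inj_onI)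
      fix i j assume "i \<in> {1..n}" "j \<in> {1..n}" "\<sigma> i = \<sigma> j"
      then have "\<tau> (Suc i) = \<tau> (Suc j)"
        using skip_\<sigma> [of i] skip_\<sigma> [of j] by simp
      then show "i = j" using permutes_inj [OF \<tau>] by (simp add: inj_eq)
    qed
    have "\<sigma> i \<in> {1..n}" if "i \<in> {1..n}" for i
    proof -
      have "\<tau> (Suc i) \<in> {1..Suc n}" using permutes_in_image [OF \<tau>, of "Suc i"] that by simp
      then show ?thesis
        using k that neq [of "Suc i"] by (auto simp: \<sigma>_def)
    qed
    then have "\<sigma> ` {1..n} = {1..n}"
      by (intro endo_inj_surj [OF _ _ inj]) auto
    with inj show "bij_betw \<sigma> {1..n} {1..n}"
      by (simp add: bij_betw_def)
    show "\<sigma> i = i" if "i \<notin> {1..n}" for i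
      using that permutes_not_in [OF \<tau>, of "Suc i"] k by (auto simp: \<sigma>_def)
  qed
qed

lemma inj_on_insert_first: "inj_on (insert_first k) {\<sigma>. \<sigma> permutes {1..n}}"
proof (rule inj_onI, rule ext)
  fix \<sigma> \<sigma>' i
  assume p: "\<sigma> \<in> {\<sigma>. \<sigma> permutes {1..n}}" "\<sigma>' \<in> {\<sigma>. \<sigma> permutes {1..n}}"
    and eq: "insert_first k \<sigma> = insert_first k \<sigma>'"
  show "\<sigma> i = \<sigma>' i"
  proof (cases "i = 0")
    case True
    then show ?thesis using p by (simp add: permutes_not_in)
  next
    case False
    then show ?thesis using fun_cong [OF eq, of "Suc i"] by (simp add: insert_first_def)
  qed
qed

text \<open>Since \<open>skip k\<close> preserves order, the patterns that avoid position 1 are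
  those of \<open>\<sigma>\<close>. Only patterns starting with the new entry \<open>k\<close> need
  an argument.\<close>

lemma avoids_132_insert_first:
  assumes \<sigma>: "\<sigma> permutes {1..n}" and n: "n \<ge> 1" and k: "k \<ge> 1"
  shows "avoids_132 (Suc n) (insert_first k \<sigma>) \<longleftrightarrow> avoids_132 n \<sigma> \<and> \<sigma> 1 \<le> k"
proof
  let ?\<tau> = "insert_first k \<sigma>"
  have first: "?\<tau> 1 = k" by (simp add: insert_first_def)
  have shift: "?\<tau> (Suc i) = skip k (\<sigma> i)" if "i \<ge> 1" for i
    using that by (simp add: insert_first_def)
  show "avoids_132 n \<sigma> \<and> \<sigma> 1 \<le> k" if av: "avoids_132 (Suc n) ?\<tau>"
  proof
    show "avoids_132 n \<sigma>"
      unfolding avoids_132_def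
    proof clarify
      fix a b c
      assume "a \<in> {1..n}" "b \<in> {1..n}" "c \<in> {1..n}" "a < b" "b < c" "\<sigma> a < \<sigma> c" "\<sigma> c < \<sigma> b"
      then show False
        using av [unfolded avoids_132_def, simplified, rule_format, of "Suc a" "Suc b" "Suc c"]
        by (auto simp: shift)
    qed
    show "\<sigma> 1 \<le> k"
    proof (rule ccontr)
      assume "\<not> \<sigma> 1 \<le> k"
      moreover have "\<sigma> 1 \<in> {1..n}" using permutes_in_image [OF \<sigma>] n by simp
      ultimately have "k \<in> {1..n}" using k by auto
      \<comment> \<open>If \<open>\<sigma> 1 > k\<close>, the value \<open>k\<close> occurs in
        \<open>\<sigma>\<close> at some later position \<open>p\<close> and is raised to
        \<open>Suc k\<close>. Positions \<open>1\<close>, \<open>Suc 1\<close> and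
        \<open>Suc p\<close> of the new permutation then form a 132 pattern.\<close>
      then obtain p where p: "p \<in> {1..n}" "\<sigma> p = k"
        using permutes_image [OF \<sigma>] by (metis imageE)
      with \<open>\<not> \<sigma> 1 \<le> k\<close> have "p \<noteq> 1" by auto
      with p have "Suc 1 < Suc p" by auto
      moreover have "?\<tau> 1 < ?\<tau> (Suc p)"
        using p by (simp add: shift first del: One_nat_def)
      moreover have "?\<tau> (Suc p) < ?\<tau> (Suc 1)"
        using p \<open>\<not> \<sigma> 1 \<le> k\<close> unfolding shift [OF order_refl]
        by (simp add: shift)
      moreover have "1 \<in> {1..Suc n}" "Suc 1 \<in> {1..Suc n}" "Suc p \<in> {1..Suc n}"
        using p n by auto
      ultimately show False
        using av unfolding avoids_132_def by (meson lessI)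
    qed
  qed
  show "avoids_132 (Suc n) ?\<tau>" if "avoids_132 n \<sigma> \<and> \<sigma> 1 \<le> k"
    unfolding avoids_132_def
  proof clarify
    from that have av: "avoids_132 n \<sigma>" and le: "\<sigma> 1 \<le> k" by auto
    fix a b c
    assume abc: "a \<in> {1..Suc n}" "b \<in> {1..Suc n}" "c \<in> {1..Suc n}" "a < b" "b < c"
      and *: "?\<tau> a < ?\<tau> c" "?\<tau> c < ?\<tau> b"
    define b' c' where "b' = b - 1" and "c' = c - 1"
    have bc': "b = Suc b'" "c = Suc c'" "b' \<in> {1..n}" "c' \<in> {1..n}" "b' < c'"
      using abc by (auto simp: b'_def c'_def)
    have lt: "\<sigma> c' < \<sigma> b'" using * bc' by (simp add: shift)
    show False
    proof (cases "a = 1")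
      case True
      \<comment> \<open>The new first entry can be replaced by \<open>\<sigma> 1\<close>: from
        \<open>\<sigma> 1 \<le> k \<le> \<sigma> c' < \<sigma> b'\<close> and injectivity, positions
        \<open>1\<close>, \<open>b'\<close>, \<open>c'\<close> form a 132 pattern in
        \<open>\<sigma>\<close>.\<close>
      with * bc' have "k \<le> \<sigma> c'" by (simp add: shift first del: One_nat_def)
      with lt le have "b' \<noteq> 1" by auto
      moreover have "\<sigma> c' \<noteq> \<sigma> 1"
        using bc' permutes_inj [OF \<sigma>] by (auto simp: inj_eq)
      ultimately have "1 < b'" "\<sigma> 1 < \<sigma> c'"
        using bc' le \<open>k \<le> \<sigma> c'\<close> by auto
      with lt bc' n av show False
        unfolding avoids_132_def by (meson atLeastAtMost_iff le_refl)
    next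
      case False
      define a' where "a' = a - 1"
      have a': "a = Suc a'" "a' \<in> {1..n}" "a' < b'"
        using abc False by (auto simp: a'_def b'_def)
      then have "\<sigma> a' < \<sigma> c'" using * bc' by (simp add: shift)
      with lt a' bc' av show False unfolding avoids_132_def by blast
    qed
  qed
qed

section \<open>Recursion for the ballot numbers\<close>

lemma finite_avoiders: "finite {\<tau>. \<tau> permutes {1..n::nat} \<and> P \<tau>}"
  by (rule finite_subset [of _ "{\<tau>. \<tau> permutes {1..n}}"]) (auto simp: finite_permutations)

text \<open>Deleting the first entry \<open>k\<close> leaves an avoider of length \<open>n\<close>
  whose own first entry \<open>j\<close> is at most \<open>k\<close>. The minimum appears because
  \<open>k\<close> may be \<open>Suc n\<close> while \<open>j \<le> n\<close>.\<close>

lemma ballot_number_Suc: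
  assumes n: "n \<ge> 1" and k: "k \<in> {1..Suc n}"
  shows "ballot_number (Suc n) k = (\<Sum>j\<in>{1..min k n}. ballot_number n j)"
proof -
  let ?A = "{\<sigma>. \<sigma> permutes {1..n} \<and> avoids_132 n \<sigma> \<and> \<sigma> 1 \<le> k}"
  have "{\<tau>. \<tau> permutes {1..Suc n} \<and> avoids_132 (Suc n) \<tau> \<and> \<tau> 1 = k} = insert_first k ` ?A"
  proof (intro equalityI subsetI)
    fix \<tau> assume "\<tau> \<in> {\<tau>. \<tau> permutes {1..Suc n} \<and> avoids_132 (Suc n) \<tau> \<and> \<tau> 1 = k}"
    then have \<tau>: "\<tau> permutes {1..Suc n}" "avoids_132 (Suc n) \<tau>" "\<tau> 1 = k" by auto
    obtain \<sigma> where "\<sigma> permutes {1..n}" "\<tau> = insert_first k \<sigma>"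
      using insert_first_surj [OF \<tau>(1)] \<tau>(3) by metis
    with \<tau> n k show "\<tau> \<in> insert_first k ` ?A"
      by (auto simp: avoids_132_insert_first)
  next
    fix \<tau> assume "\<tau> \<in> insert_first k ` ?A"
    with n k show "\<tau> \<in> {\<tau>. \<tau> permutes {1..Suc n} \<and> avoids_132 (Suc n) \<tau> \<and> \<tau> 1 = k}"
      using insert_first_permutes [of _ n k]
      by (auto simp: avoids_132_insert_first) (simp add: insert_first_def)
  qed
  then have "ballot_number (Suc n) k = card ?A"
    unfolding ballot_number_def
    by (simp add: card_image inj_on_subset [OF inj_on_insert_first [of k n]] Collect_mono)
  also have "\<dots> = (\<Sum>j\<in>{1..min k n}. card {\<sigma> \<in> ?A. \<sigma> 1 = j})"
  proof (rule card_eq_sum_card_fibres)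
    have "\<sigma> 1 \<in> {1..n}" if "\<sigma> permutes {1..n}" for \<sigma>
      using permutes_in_image [OF that] n by simp
    then show "(\<lambda>\<sigma>. \<sigma> 1) ` ?A \<subseteq> {1..min k n}" by auto
  qed (simp_all only: finite_avoiders finite_atLeastAtMost)
  also have "\<dots> = (\<Sum>j\<in>{1..min k n}. ballot_number n j)"
    unfolding ballot_number_def
    by (intro sum.cong refl arg_cong [where f = card]) auto
  finally show ?thesis .
qed

lemma catalan_number_eq_sum_ballot:
  assumes "n \<ge> 1"
  shows "catalan_number n = (\<Sum>k\<in>{1..n}. ballot_number n k)"
proof -
  let ?A = "{\<sigma>. \<sigma> permutes {1..n} \<and> avoids_132 n \<sigma>}"
  have "card ?A = (\<Sum>k\<in>{1..n}. card {\<sigma> \<in> ?A. \<sigma> 1 = k})"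
  proof (rule card_eq_sum_card_fibres)
    have "\<sigma> 1 \<in> {1..n}" if "\<sigma> permutes {1..n}" for \<sigma>
      using permutes_in_image [OF that] assms by simp
    then show "(\<lambda>\<sigma>. \<sigma> 1) ` ?A \<subseteq> {1..n}" by auto
  qed (simp_all only: finite_avoiders finite_atLeastAtMost)
  then show ?thesis
    by (simp add: catalan_number_def ballot_number_def conj_assoc)
qed

lemma ballot_number_1: "ballot_number 1 1 = 1"
proof -
  have "{\<tau>::nat \<Rightarrow> nat. \<tau> permutes {1..1} \<and> avoids_132 1 \<tau> \<and> \<tau> 1 = 1} = {id}"
    by (auto simp: avoids_132_def)
  then show ?thesis by (simp add: ballot_number_def)
qed

section \<open>Matching the two recursions\<close>

lemma sum_atLeast1_shift: "(\<Sum>j\<in>{1..Suc m}. f j) = (\<Sum>j\<le>m. f (Suc j))"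
  by (simp only: One_nat_def sum.atLeast1_atMost_eq lessThan_Suc_atMost)

text \<open>Both sides satisfy the same recursion after shifting first entries by one: the label
  \<open>N + 1\<close> at index \<open>N\<close> caps the last entry just as the length
  \<open>N + 2\<close> caps the next first entry. Both sides equal 1 for
  \<open>N = 0\<close>.\<close>

lemma ballot_number_eq_card_bounded_seqs:
  assumes "m \<le> Suc N"
  shows "ballot_number (N + 2) (Suc m) = card (bounded_seqs N standard_labels m)"
  using assms
proof (induction N arbitrary: m)
  case 0
  have "bounded_seqs 0 standard_labels m = {\<lambda>_. undefined}"
    by (auto simp: bounded_seqs_def mono_on_def)
  moreover have "ballot_number (Suc 1) (Suc m) = 1"
    using 0 by (subst ballot_number_Suc) (auto simp: ballot_number_1 simp del: One_nat_def)
  ultimately show ?case by (simp add: numeral_2_eq_2)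
next
  case (Suc N)
  have "ballot_number (Suc N + 2) (Suc m) =
      (\<Sum>j\<in>{1..Suc (min m (Suc N))}. ballot_number (N + 2) j)"
    using Suc.prems ballot_number_Suc [of "N + 2" "Suc m"] by simp
  also have "\<dots> = (\<Sum>j\<le>min m (Suc N). card (bounded_seqs N standard_labels j))"
    unfolding sum_atLeast1_shift by (intro sum.cong) (auto simp: Suc.IH simp del: add_2_eq_Suc')
  also have "\<dots> = card (bounded_seqs (Suc N) standard_labels m)"
    by (simp add: card_bounded_seqs_Suc standard_labels_def)
  finally show ?case .
qed

theorem theorem5:
  shows "(\<forall>n\<ge>2. card (\<Omega> (n - 1)) = catalan_number n) \<and>
         (\<forall>n\<ge>3. \<forall>k\<in>{2..n + 1}.
            card {\<omega> \<in> \<Omega> (n - 1). \<omega> (final_edge (n - 1)) = n + 1 - k}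
              = card (zigzag_covers (n - 2) (standard_labels(n - 2 := n + 1 - k))) \<and>
            card (zigzag_covers (n - 2) (standard_labels(n - 2 := n + 1 - k)))
              = ballot_number n (n + 2 - k))"
proof (intro conjI allI impI ballI)
  fix n :: nat assume "n \<ge> 2"
  define N where "N = n - 2"
  have n: "n = N + 2" using \<open>n \<ge> 2\<close> by (simp add: N_def)
  have "catalan_number n = (\<Sum>j\<le>Suc N. ballot_number (N + 2) (Suc j))"
    using catalan_number_eq_sum_ballot [of "Suc (Suc N)"]
    by (simp only: n sum_atLeast1_shift add_2_eq_Suc')
  also have "\<dots> = (\<Sum>j\<le>Suc N. card (bounded_seqs N standard_labels j))"
    by (intro sum.cong) (auto simp del: add_2_eq_Suc' simp: ballot_number_eq_card_bounded_seqs)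
  \<comment> \<open>The bound from the last label is \<open>N + 2\<close>, but the preceding label
    \<open>N + 1\<close> is smaller and sets the summation range.\<close>
  also have "\<dots> = card (\<Omega> (Suc N))"
    by (simp add: \<Omega>_def card_zigzag_covers card_bounded_seqs_Suc standard_labels_def)
  finally show "card (\<Omega> (n - 1)) = catalan_number n" by (simp add: n)
next
  fix n k :: nat assume "n \<ge> 3" and k: "k \<in> {2..n + 1}"
  define N m where "N = n - 2" and "m = n + 1 - k"
  have n: "n - 1 = Suc N" "n - 2 = N" "n = N + 2" "N \<ge> 1" and m: "m \<le> Suc N" "n + 2 - k = Suc m"
    using \<open>n \<ge> 3\<close> k by (auto simp: N_def m_def)
  \<comment> \<open>The modified label at \<open>N\<close> enters only as the bound
    \<open>m\<close>; the entries of the sequence have indices below \<open>N\<close>.\<close>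
  have smaller: "card (zigzag_covers N (standard_labels(N := m))) = card (bounded_seqs N standard_labels m)"
    using n by (simp add: card_zigzag_covers bounded_seqs_def cong: conj_cong)
  show "card {\<omega> \<in> \<Omega> (n - 1). \<omega> (final_edge (n - 1)) = n + 1 - k}
      = card (zigzag_covers (n - 2) (standard_labels(n - 2 := n + 1 - k)))"
    unfolding n(1,2) m_def [symmetric] smaller \<Omega>_def
    using m(1) by (simp add: card_zigzag_covers_final_edge standard_labels_def)
  show "card (zigzag_covers (n - 2) (standard_labels(n - 2 := n + 1 - k)))
      = ballot_number n (n + 2 - k)"
    unfolding n(2) m(2) m_def [symmetric] smaller
    using m(1) n(3) ballot_number_eq_card_bounded_seqs [of m N] by simp
qed

end
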